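(* Let $(K,v)$ be a henselian valued field and let $F\in K[X]$ be a monic irreducible polynomial having a root $\theta$ in $\overline K$. Then $(F=F_r,F_{r-1},\ldots,F_0)$ is a saturated distinguished chain for $F$ if and only if $[F_0,F_1,\ldots,F_{r-1}]$ is an Okutsu frame of $F$.
   Context: Valuations have arbitrary rank. $\overline K$ is a fixed algebraic closure of $K$, $\bar v$ is the unique extension of $v$ to $\overline K$, and $\deg\alpha:=[K(\alpha):K]$ for $\alpha\in\overline K$. Distinguished pairs: a pair $(\theta,\alpha)$ of elements of $\overline K$ is a $(K,v)$-distinguished pair if (i) $\deg\theta>\deg\alpha$; (ii) $\bar v(\theta-\alpha)=\max\{\bar v(\theta-\beta)\mid\beta\in\overline K,\ \deg\beta<\deg\theta\}$; (iii) every $\eta\in\overline K$ with $\deg\eta<\deg\alpha$ satisfies $\bar v(\theta-\eta)<\bar v(\theta-\alpha)$. For monic irreducible $g,f\in K[X]$, $(g,f)$ is a distinguished pair if some root $\theta$ of $g$ and some root $\alpha$ of $f$ form a $(K,v)$-distinguished pair. A sequence $(F_r=F,F_{r-1},\ldots,F_0)$ of monic irreducible polynomials is a saturated distinguished chain for $F$ if $(F_{i+1},F_i)$ is a distinguished pair for each $0\le i\le r-1$ and $\deg F_0=1$. Okutsu frames: let $F$ be monic irreducible of degree $n$ with root $\theta$. Consider sequences $1=m_0<m_1<\cdots<m_r=n$ and $\mu_0<\mu_1<\cdots<\mu_r=\infty$ defined recursively by $$\mu_i:=\max\{\bar v(\theta-\eta)\mid\eta\in\overline K,\ \deg\eta=m_i\}\quad(0\le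 i\le r-1),$$ $$m_i:=\min\{\deg\eta\mid\eta\in\overline K,\ \bar v(\theta-\eta)>\mu_{i-1}\}\quad(i\ge1),$$ where the recursion stops at the index $r$ for which this minimum equals $n$, so $m_r=n$ (if $n=1$ then $r=0$). All the maxima are required to exist. These values do not depend on the choice of the root $\theta$, since $v$ is henselian. If $\theta_i\in\overline K$ satisfies $\deg\theta_i=m_i$ and $\bar v(\theta-\theta_i)=\mu_i$ for every $0\le i\le r-1$, and $F_i$ is the minimal polynomial of $\theta_i$ over $K$, then the list $[F_0,F_1,\ldots,F_{r-1}]$ is called an Okutsu frame of $F$. *)

theory Defs
  imports "HOL-Algebra.Algebraic_Closure_Type" "HOL-Library.Extended"
begin

section \<open>Valuations and henselian fields\<close>

text \<open>
  Value groups are arbitrary linearly ordered abelian groups, so the rank is unrestricted and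
  the trivial valuation is allowed.  The type \<open>'g extended\<close> also contains
  \<open>-\<infinity>\<close>, which is not a possible value.
\<close>

definition valuation :: "('k::field \<Rightarrow> 'g::linordered_ab_group_add extended) \<Rightarrow> bool" where
  "valuation v \<longleftrightarrow>
     (\<forall>x. v x \<noteq> -\<infinity>) \<and>
     (\<forall>x. v x = \<infinity> \<longleftrightarrow> x = 0) \<and>
     (\<forall>x y. v (x * y) = v x + v y) \<and>
     (\<forall>x y. min (v x) (v y) \<le> v (x + y))"

text \<open>
  The value group of the extension may live in a different type (it is the divisible hull of
  the value group of \<^term>\<open>v\<close>); the map \<open>j\<close> is the embedding of ordered groups along which the
  values of \<^term>\<open>v\<close> are regarded as values of \<^term>\<open>w\<close>.
\<close>

definition extends_valuation ::
  "('k::field alg_closure \<Rightarrow> 'h::linordered_ab_group_add extended) \<Rightarrow>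
   ('k \<Rightarrow> 'g::linordered_ab_group_add extended) \<Rightarrow> bool" where
  "extends_valuation w v \<longleftrightarrow>
     (\<exists>j. (\<forall>a b. j (a + b) = j a + j b) \<and> strict_mono j \<and>
          (\<forall>x. w (to_ac x) = map_extended j (v x)))"

definition valuation_subring :: "'l::field set \<Rightarrow> bool" where
  "valuation_subring A \<longleftrightarrow>
     1 \<in> A \<and> (\<forall>x\<in>A. \<forall>y\<in>A. x - y \<in> A \<and> x * y \<in> A) \<and> (\<forall>x. x \<in> A \<or> inverse x \<in> A)"

text \<open>
  Henselian means that the valuation has exactly one extension to the algebraic closure.
  Extensions of valuations are counted up to equivalence, that is, by their valuation rings;
  this also covers extensions with values in any ordered group.
\<close>

definition henselian :: "('k::field \<Rightarrow> 'g::linordered_ab_group_add extended) \<Rightarrow> bool" where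
  "henselian v \<longleftrightarrow>
     (\<exists>!A :: 'k alg_closure set. valuation_subring A \<and> to_ac -` A = {x. 0 \<le> v x})"


section \<open>Degrees and minimal polynomials\<close>

definition is_subfield :: "'l::field set \<Rightarrow> bool" where
  "is_subfield L \<longleftrightarrow>
     1 \<in> L \<and> (\<forall>x\<in>L. \<forall>y\<in>L. x - y \<in> L \<and> x * y \<in> L) \<and> (\<forall>x\<in>L. inverse x \<in> L)"

definition adjoin :: "'k::field alg_closure \<Rightarrow> 'k alg_closure set" where
  "adjoin \<alpha> = \<Inter>{L. is_subfield L \<and> range to_ac \<subseteq> L \<and> \<alpha> \<in> L}"

lemma vector_space_alg_closure: "vector_space (\<lambda>c x :: 'k::field alg_closure. to_ac c * x)"
  by unfold_locales (simp_all add: algebra_simps)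

definition deg :: "'k::field alg_closure \<Rightarrow> nat" where
  "deg \<alpha> = vector_space.dim (\<lambda>c x. to_ac c * x) (adjoin \<alpha>)"

definition is_root :: "'k::field poly \<Rightarrow> 'k alg_closure \<Rightarrow> bool" where
  "is_root p \<alpha> \<longleftrightarrow> poly (map_poly to_ac p) \<alpha> = 0"

definition monic_irreducible :: "'k::field poly \<Rightarrow> bool" where
  "monic_irreducible p \<longleftrightarrow> lead_coeff p = 1 \<and> irreducible p"

definition is_min_poly :: "'k::field poly \<Rightarrow> 'k alg_closure \<Rightarrow> bool" where
  "is_min_poly p \<alpha> \<longleftrightarrow> lead_coeff p = 1 \<and> is_root p \<alpha> \<and>
     (\<forall>q. q \<noteq> 0 \<and> is_root q \<alpha> \<longrightarrow> degree p \<le> degree q)"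


section \<open>Distinguished pairs and chains\<close>

text \<open>The maximum of a possibly infinite set; asserts that the maximum exists.\<close>

definition is_maximum :: "'b::order \<Rightarrow> 'b set \<Rightarrow> bool" where
  "is_maximum x S \<longleftrightarrow> x \<in> S \<and> (\<forall>y\<in>S. y \<le> x)"

definition distinguished_pair ::
  "('k::field alg_closure \<Rightarrow> 'h::linordered_ab_group_add extended) \<Rightarrow>
   'k alg_closure \<Rightarrow> 'k alg_closure \<Rightarrow> bool" where
  "distinguished_pair w \<theta> \<alpha> \<longleftrightarrow>
     deg \<theta> > deg \<alpha> \<and>
     is_maximum (w (\<theta> - \<alpha>)) {w (\<theta> - \<beta>) | \<beta>. deg \<beta> < deg \<theta>} \<and>
     (\<forall>\<eta>. deg \<eta> < deg \<alpha> \<longrightarrow> w (\<theta> - \<eta>) < w (\<theta> - \<alpha>))"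

definition distinguished_pair_poly ::
  "('k::field alg_closure \<Rightarrow> 'h::linordered_ab_group_add extended) \<Rightarrow>
   'k poly \<Rightarrow> 'k poly \<Rightarrow> bool" where
  "distinguished_pair_poly w g f \<longleftrightarrow>
     monic_irreducible g \<and> monic_irreducible f \<and>
     (\<exists>\<theta> \<alpha>. is_root g \<theta> \<and> is_root f \<alpha> \<and> distinguished_pair w \<theta> \<alpha>)"

text \<open>The chain is listed from \<open>F\<^sub>r = F\<close> down to \<open>F\<^sub>0\<close>.\<close>

definition saturated_distinguished_chain ::
  "('k::field alg_closure \<Rightarrow> 'h::linordered_ab_group_add extended) \<Rightarrow>
   'k poly \<Rightarrow> 'k poly list \<Rightarrow> bool" where
  "saturated_distinguished_chain w F Gs \<longleftrightarrow>
     Gs \<noteq> [] \<and> hd Gs = F \<and> (\<forall>G\<in>set Gs. monic_irreducible G) \<and>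
     (\<forall>i. Suc i < length Gs \<longrightarrow> distinguished_pair_poly w (Gs ! i) (Gs ! Suc i)) \<and>
     degree (last Gs) = 1"


section \<open>Okutsu frames\<close>

text \<open>
  Only \<open>m i\<close> and \<open>\<mu> i\<close> with \<open>i \<le> r\<close> matter.  The strict inequalities \<open>m i < m (Suc i)\<close> make
  \<open>r\<close> the first index with \<open>m r = degree F\<close>, where the recursion stops.  The set over which the
  least degree is taken contains the degree of \<open>\<theta>\<close>, since \<open>w 0 = \<infinity>\<close> and \<open>\<mu> i < \<infinity>\<close>.
\<close>

definition okutsu_sequences ::
  "('k::field alg_closure \<Rightarrow> 'h::linordered_ab_group_add extended) \<Rightarrow>
   'k poly \<Rightarrow> 'k alg_closure \<Rightarrow> nat \<Rightarrow> (nat \<Rightarrow> nat) \<Rightarrow> (nat \<Rightarrow> 'h extended) \<Rightarrow> bool" where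
  "okutsu_sequences w F \<theta> r m \<mu> \<longleftrightarrow>
     m 0 = 1 \<and> m r = degree F \<and> \<mu> r = \<infinity> \<and>
     (\<forall>i<r. m i < m (Suc i) \<and> \<mu> i < \<mu> (Suc i)) \<and>
     (\<forall>i<r. is_maximum (\<mu> i) {w (\<theta> - \<eta>) | \<eta>. deg \<eta> = m i}) \<and>
     (\<forall>i<r. m (Suc i) = (LEAST d. \<exists>\<eta>. deg \<eta> = d \<and> w (\<theta> - \<eta>) > \<mu> i))"

text \<open>The list is \<open>[F\<^sub>0, \<dots>, F\<^sub>r\<^sub>-\<^sub>1]\<close>, computed with respect to the root \<open>\<theta>\<close> of \<open>F\<close>.\<close>

definition okutsu_frame ::
  "('k::field alg_closure \<Rightarrow> 'h::linordered_ab_group_add extended) \<Rightarrow>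
   'k poly \<Rightarrow> 'k alg_closure \<Rightarrow> 'k poly list \<Rightarrow> bool" where
  "okutsu_frame w F \<theta> Fs \<longleftrightarrow>
     monic_irreducible F \<and> is_root F \<theta> \<and>
     (\<exists>m \<mu>. okutsu_sequences w F \<theta> (length Fs) m \<mu> \<and>
        (\<forall>i<length Fs. \<exists>\<theta>\<^sub>i. deg \<theta>\<^sub>i = m i \<and> w (\<theta> - \<theta>\<^sub>i) = \<mu> i \<and> is_min_poly (Fs ! i) \<theta>\<^sub>i))"

end

theory Submission
  imports Defs
begin

text \<open>
  Suppose that every polynomial of the chain has a chosen root: \<open>t i\<close> for \<open>F\<^sub>i\<close>, with
  \<open>t r = \<theta>\<close>.  Then both sides of the equivalence are statements about distances
  between elements of the algebraic closure.  A distinguished chain compares \<open>t i\<close> with its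
  neighbour \<open>t (Suc i)\<close>, an Okutsu frame compares every \<open>t i\<close> with \<open>\<theta>\<close>.  In both cases the
  points approach \<open>\<theta>\<close> strictly, so by the ultrametric inequality \<open>\<theta>\<close> and \<open>t (Suc i)\<close> cannot
  be distinguished at the distance of \<open>t i\<close>, and one kind of comparison can be replaced by the
  other.  This is \<open>okutsu_sequences_iff_distinguished_pairs\<close>.

  What remains is to choose the roots.  In a frame all roots refer to the same \<open>\<theta>\<close>.  In a chain
  of polynomials the root of \<open>F\<^sub>i\<close> that is paired with a root of \<open>F\<^sub>i\<^sub>-\<^sub>1\<close> may differ from the root
  that is paired with one of \<open>F\<^sub>i\<^sub>+\<^sub>1\<close>, and the pairs have to be moved by conjugation until they
  fit together, starting from \<open>\<theta>\<close> (\<open>distinguished_pair_poly_root\<close>).  Conjugation preserves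
  degrees because it preserves minimal polynomials, and it preserves the valuation because the
  base field is henselian (\<open>henselian_val_hom\<close>).

  The homomorphisms that carry a given root of an irreducible polynomial to another one
  (\<open>conjugate_roots\<close>) come from Zorn's lemma.  They are treated as injective endomorphisms
  throughout: the uniqueness of the extended valuation ring is applied to a preimage, and when a
  pair is moved to another root, a second homomorphism in the opposite direction takes the place
  of the inverse.
\<close>

section \<open>Evaluating polynomials over the base field\<close>

abbreviation eval_ac :: "'k::field poly \<Rightarrow> 'k alg_closure \<Rightarrow> 'k alg_closure" where
  "eval_ac p x \<equiv> poly (map_poly to_ac p) x"

lemma eval_ac_pCons [simp]: "eval_ac (pCons c p) x = to_ac c + x * eval_ac p x"
  by (simp add: map_poly_pCons)

lemma eval_ac_add [simp]: "eval_ac (p + q) x = eval_ac p x + eval_ac q x"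
  by (induction p q rule: poly_induct2) (simp_all add: algebra_simps)

lemma eval_ac_uminus [simp]: "eval_ac (- p) x = - eval_ac p x"
  by (induction p) simp_all

lemma eval_ac_diff [simp]: "eval_ac (p - q) x = eval_ac p x - eval_ac q x"
  using eval_ac_add[of p "- q" x] by simp

lemma eval_ac_smult [simp]: "eval_ac (smult c p) x = to_ac c * eval_ac p x"
  by (induction p) (simp_all add: algebra_simps)

lemma eval_ac_mult [simp]: "eval_ac (p * q) x = eval_ac p x * eval_ac q x"
  by (induction p) (simp_all add: algebra_simps)

lemma eval_ac_pcompose: "eval_ac (pcompose p q) x = eval_ac p (eval_ac q x)"
  by (induction p) (simp_all add: pcompose_pCons)

lemma eval_ac_altdef:
  assumes "degree p < n"
  shows "eval_ac p x = (\<Sum>i<n. to_ac (coeff p i) * x ^ i)"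
proof -
  have "eval_ac p x = (\<Sum>i\<le>degree p. to_ac (coeff p i) * x ^ i)"
    by (simp add: poly_altdef coeff_map_poly degree_map_poly)
  also have "\<dots> = (\<Sum>i<n. to_ac (coeff p i) * x ^ i)"
    by (rule sum.mono_neutral_left) (use assms in \<open>auto simp: coeff_eq_0\<close>)
  finally show ?thesis .
qed


section \<open>Minimal polynomials\<close>

lemma irreducible_degree_pos:
  fixes p :: "'a::field poly"
  assumes "irreducible p"
  shows "degree p > 0"
proof -
  have "p \<noteq> 0" using assms by (simp add: irreducible_def)
  moreover have "\<not> p dvd 1" using assms by (simp add: irreducible_not_unit)
  ultimately show ?thesis by (simp add: is_unit_iff_degree)
qed

lemma is_min_poly_dvd:
  assumes p: "is_min_poly p \<alpha>" and q: "is_root q \<alpha>"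
  shows "p dvd q"
proof -
  have "p \<noteq> 0"
    using p by (auto simp: is_min_poly_def)
  have "is_root (q mod p) \<alpha>"
    using p q eval_ac_add[of "q div p * p" "q mod p" \<alpha>] by (simp add: is_min_poly_def is_root_def)
  then have "q mod p = 0"
    using p degree_mod_less[OF \<open>p \<noteq> 0\<close>, of q] by (force simp: is_min_poly_def)
  then show ?thesis
    by (simp add: mod_eq_0_iff_dvd)
qed

lemma is_min_poly_exists: obtains p where "is_min_poly p \<alpha>"
proof -
  let ?P = "\<lambda>p. p \<noteq> 0 \<and> is_root p \<alpha>"
  obtain p0 where "?P p0"
    using alg_closure_algebraic[of \<alpha>] by (auto simp: is_root_def)
  then obtain p where p: "?P p" "\<And>q. ?P q \<Longrightarrow> degree p \<le> degree q"
    using ex_has_least_nat[of ?P p0 degree] by blast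
  let ?q = "smult (inverse (lead_coeff p)) p"
  have "is_min_poly ?q \<alpha>"
    using p by (simp add: is_min_poly_def is_root_def)
  then show ?thesis ..
qed

lemma is_min_poly_irreducible:
  assumes p: "is_min_poly p \<alpha>"
  shows "irreducible p"
proof (rule irreducibleI)
  show "p \<noteq> 0"
    using p by (auto simp: is_min_poly_def)
  show "\<not> p dvd 1"
  proof
    assume "p dvd 1"
    then obtain q where "1 = p * q" by (elim dvdE)
    then have "eval_ac p \<alpha> * eval_ac q \<alpha> = 1"
      using eval_ac_mult[of p q \<alpha>] by simp
    then show False
      using p by (simp add: is_min_poly_def is_root_def)
  qed
next
  have unit: "b dvd 1" if "p = a * b" "is_root a \<alpha>" for a b
  proof -
    have "p \<noteq> 0" using p by (auto simp: is_min_poly_def)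
    with that have "a \<noteq> 0" "b \<noteq> 0" by auto
    then have "degree p \<le> degree a"
      using p that by (auto simp: is_min_poly_def)
    with that \<open>a \<noteq> 0\<close> \<open>b \<noteq> 0\<close> have "degree b = 0"
      by (simp add: degree_mult_eq)
    with \<open>b \<noteq> 0\<close> show ?thesis
      by (simp add: is_unit_iff_degree)
  qed
  fix a b assume ab: "p = a * b"
  then have "is_root a \<alpha> \<or> is_root b \<alpha>"
    using p by (simp add: is_min_poly_def is_root_def)
  then show "a dvd 1 \<or> b dvd 1"
    using unit[of a b] unit[of b a] ab by (auto simp: mult.commute)
qed

text \<open>
  The minimal polynomial divides \<open>p\<close> and is not a unit, so it is associated with \<open>p\<close>.
\<close>

lemma irreducible_root_dvd:
  assumes p: "irreducible p" "is_root p \<alpha>" and q: "is_root q \<alpha>"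
  shows "p dvd q"
proof -
  obtain m where m: "is_min_poly m \<alpha>" by (rule is_min_poly_exists)
  have "m dvd p" using is_min_poly_dvd[OF m] p by blast
  moreover have "\<not> m dvd 1"
    using is_min_poly_irreducible[OF m] by (simp add: irreducible_not_unit)
  ultimately have "p dvd m" using p irreducibleD' by blast
  with is_min_poly_dvd[OF m q] show ?thesis by (rule dvd_trans[rotated])
qed

lemma is_min_poly_iff: "is_min_poly p \<alpha> \<longleftrightarrow> monic_irreducible p \<and> is_root p \<alpha>"
proof
  assume "is_min_poly p \<alpha>"
  then show "monic_irreducible p \<and> is_root p \<alpha>"
    using is_min_poly_irreducible by (auto simp: is_min_poly_def monic_irreducible_def)
next
  assume p: "monic_irreducible p \<and> is_root p \<alpha>"
  then have "degree p \<le> degree q" if "q \<noteq> 0" "is_root q \<alpha>" for q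
    using that by (intro dvd_imp_degree_le irreducible_root_dvd) (auto simp: monic_irreducible_def)
  with p show "is_min_poly p \<alpha>"
    by (auto simp: is_min_poly_def monic_irreducible_def)
qed

text \<open>
  If \<open>x * s(x) + c = 0\<close> is the minimal equation of \<open>x\<close>, then \<open>c \<noteq> 0\<close> by minimality, and
  dividing by \<open>c\<close> exhibits the inverse.  This makes every ring between the base field and
  its algebraic closure a field.
\<close>

lemma inverse_eq_eval_ac:
  fixes x :: "'k::field alg_closure"
  assumes "x \<noteq> 0"
  obtains s where "x * eval_ac s x = 1"
proof -
  obtain m where m: "is_min_poly m x" by (rule is_min_poly_exists)
  obtain c s where ms: "m = pCons c s" by (cases m) auto
  have nz: "m \<noteq> 0" using m by (auto simp: is_min_poly_def)
  have c: "c \<noteq> 0"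
  proof
    assume "c = 0"
    with ms nz have "s \<noteq> 0" by auto
    have "is_root s x"
      using m assms by (simp add: is_min_poly_def is_root_def ms \<open>c = 0\<close>)
    then have "degree m \<le> degree s"
      using m \<open>s \<noteq> 0\<close> by (auto simp: is_min_poly_def)
    then show False using ms \<open>s \<noteq> 0\<close> by simp
  qed
  have "to_ac c + x * eval_ac s x = 0"
    using m by (simp add: is_min_poly_def is_root_def ms)
  then have "x * eval_ac s x = - to_ac c"
    by (simp add: eq_neg_iff_add_eq_0 add.commute)
  moreover have "x * eval_ac (smult (- inverse c) s) x = to_ac (- inverse c) * (x * eval_ac s x)"
    by simp
  ultimately have "x * eval_ac (smult (- inverse c) s) x = 1"
    using c by simp
  then show ?thesis ..
qed


section \<open>The degree of an element\<close>

lemma is_subfieldD: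
  assumes "is_subfield L"
  shows is_subfield_0: "0 \<in> L" and is_subfield_1: "1 \<in> L"
    and is_subfield_uminus: "x \<in> L \<Longrightarrow> - x \<in> L"
    and is_subfield_add: "x \<in> L \<Longrightarrow> y \<in> L \<Longrightarrow> x + y \<in> L"
    and is_subfield_mult: "x \<in> L \<Longrightarrow> y \<in> L \<Longrightarrow> x * y \<in> L"
proof -
  show 1: "1 \<in> L" using assms by (simp add: is_subfield_def)
  have d: "x - y \<in> L" if "x \<in> L" "y \<in> L" for x y
    using assms that by (simp add: is_subfield_def)
  show 0: "0 \<in> L" using d[OF 1 1] by simp
  show m: "- x \<in> L" if "x \<in> L" for x using d[OF 0 that] by simp
  show "x + y \<in> L" if "x \<in> L" "y \<in> L" for x y using d[OF that(1) m[OF that(2)]] by simp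
  show "x * y \<in> L" if "x \<in> L" "y \<in> L" for x y
    using assms that by (simp add: is_subfield_def)
qed

lemma adjoin_eq_range_eval_ac: "adjoin \<alpha> = range (\<lambda>q. eval_ac q \<alpha>)"
proof
  let ?S = "range (\<lambda>q. eval_ac q \<alpha>)"
  have "is_subfield ?S"
    unfolding is_subfield_def
  proof (intro conjI ballI)
    show "1 \<in> ?S" by (rule range_eqI[of _ _ 1]) simp
  next
    fix x y assume "x \<in> ?S" "y \<in> ?S"
    then obtain p q where "x = eval_ac p \<alpha>" "y = eval_ac q \<alpha>" by blast
    then show "x - y \<in> ?S" "x * y \<in> ?S"
      by (metis eval_ac_diff rangeI, metis eval_ac_mult rangeI)
  next
    fix x assume x: "x \<in> ?S"
    show "inverse x \<in> ?S"
    proof (cases "x = 0")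
      case False
      then obtain s where "x * eval_ac s x = 1" by (rule inverse_eq_eval_ac)
      then have "inverse x = eval_ac s x" by (rule inverse_unique)
      with x show ?thesis by (auto simp flip: eval_ac_pcompose)
    qed (use x in simp)
  qed
  moreover have "to_ac c \<in> ?S" for c
    by (rule range_eqI[of _ _ "[:c:]"]) simp
  moreover have "\<alpha> \<in> ?S"
    by (rule range_eqI[of _ _ "[:0, 1:]"]) simp
  ultimately show "adjoin \<alpha> \<subseteq> ?S"
    by (auto simp: adjoin_def)
next
  have "eval_ac q \<alpha> \<in> L" if "is_subfield L" "range to_ac \<subseteq> L" "\<alpha> \<in> L" for q L
    using that by (induction q) (auto intro!: is_subfieldD)
  then show "range (\<lambda>q. eval_ac q \<alpha>) \<subseteq> adjoin \<alpha>"
    by (auto simp: adjoin_def)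
qed

text \<open>
  The powers \<open>\<alpha>\<^sup>i\<close> with \<open>i < degree p\<close> form a basis: reduction modulo \<open>p\<close> shows that they
  span, and a linear relation between them is a polynomial of degree below \<open>degree p\<close> that
  vanishes at \<open>\<alpha>\<close>.
\<close>

lemma deg_eq_degree:
  assumes p: "irreducible p" "is_root p \<alpha>"
  shows "deg \<alpha> = degree p"
proof -
  interpret V: vector_space "\<lambda>c x :: 'a alg_closure. to_ac c * x"
    by (rule vector_space_alg_closure)
  let ?n = "degree p" and ?B = "(\<lambda>i. \<alpha> ^ i) ` {..<degree p}"
  have "p \<noteq> 0" using p by auto
  have zero: "q = 0" if "is_root q \<alpha>" "degree q < ?n" for q
    using irreducible_root_dvd[OF p that(1)] that(2) dvd_imp_degree_le[of p q] by fastforce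
  have "?n > 0" using p by (intro irreducible_degree_pos)
  have inj: "inj_on (\<lambda>i. \<alpha> ^ i) {..<?n}"
  proof (rule inj_onI)
    fix i j assume ij: "i \<in> {..<?n}" "j \<in> {..<?n}" "\<alpha> ^ i = \<alpha> ^ j"
    have "is_root (monom 1 i - monom 1 j) \<alpha>"
      using ij by (simp add: is_root_def map_poly_monom poly_monom)
    moreover have "degree (monom (1::'a) i - monom 1 j) < ?n"
      using ij by (intro degree_diff_less) (auto simp: degree_monom_eq)
    ultimately have "monom (1::'a) i = monom 1 j" using zero by fastforce
    then show "i = j" by (metis degree_monom_eq one_neq_zero)
  qed
  have "V.dim (adjoin \<alpha>) = ?n"
  proof (rule V.dim_unique[of ?B])
    show "?B \<subseteq> adjoin \<alpha>"
    proof (rule image_subsetI)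
      fix i show "\<alpha> ^ i \<in> adjoin \<alpha>"
        unfolding adjoin_eq_range_eval_ac
        by (rule range_eqI[where x = "monom 1 i"]) (simp add: map_poly_monom poly_monom)
    qed
    show "adjoin \<alpha> \<subseteq> V.span ?B"
    proof
      fix x assume "x \<in> adjoin \<alpha>"
      then obtain q where "x = eval_ac q \<alpha>" by (auto simp: adjoin_eq_range_eval_ac)
      also have "\<dots> = eval_ac (q mod p) \<alpha>"
        using p eval_ac_add[of "q div p * p" "q mod p" \<alpha>] by (simp add: is_root_def)
      also have "\<dots> = (\<Sum>i<?n. to_ac (coeff (q mod p) i) * \<alpha> ^ i)"
        by (intro eval_ac_altdef) (use \<open>?n > 0\<close> degree_mod_less[OF \<open>p \<noteq> 0\<close>, of q] in auto)
      also have "\<dots> \<in> V.span ?B"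
        by (intro V.span_sum V.span_scale V.span_base) auto
      finally show "x \<in> V.span ?B" .
    qed
    show "V.independent ?B"
    proof (rule V.independent_if_scalars_zero)
      show "finite ?B" by simp
      fix c x assume c: "(\<Sum>b\<in>?B. to_ac (c b) * b) = 0" and x: "x \<in> ?B"
      define q where "q = (\<Sum>i<?n. monom (c (\<alpha> ^ i)) i)"
      have coeff_q: "coeff q i = (if i < ?n then c (\<alpha> ^ i) else 0)" for i
        by (simp add: q_def coeff_sum)
      have deg_q: "degree q < ?n"
        using \<open>?n > 0\<close> by (intro degree_lessI) (auto simp: coeff_q)
      have "eval_ac q \<alpha> = (\<Sum>i<?n. to_ac (c (\<alpha> ^ i)) * \<alpha> ^ i)"
        using eval_ac_altdef[OF deg_q] by (simp add: coeff_q)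
      also have "\<dots> = 0"
        using c by (simp add: sum.reindex[OF inj] o_def)
      finally have "q = 0" using zero deg_q by (simp add: is_root_def)
      with x show "c x = 0" using coeff_q by (metis coeff_0 imageE lessThan_iff)
    qed
    show "card ?B = ?n" by (simp add: card_image[OF inj])
  qed
  then show ?thesis by (simp add: deg_def)
qed

lemma deg_eq_degree_min_poly:
  assumes "is_min_poly p \<alpha>"
  shows "deg \<alpha> = degree p"
  using is_min_poly_irreducible[OF assms] by (rule deg_eq_degree) (use assms in \<open>simp add: is_min_poly_def\<close>)

lemma deg_pos: "deg \<alpha> > 0"
proof -
  obtain p where p: "is_min_poly p \<alpha>" by (rule is_min_poly_exists)
  show ?thesis
    using irreducible_degree_pos[OF is_min_poly_irreducible[OF p]] deg_eq_degree_min_poly[OF p]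
    by simp
qed


section \<open>Conjugate elements\<close>

locale closure_hom =
  fixes \<sigma> :: "'k::field alg_closure \<Rightarrow> 'k alg_closure"
  assumes hom_diff: "\<sigma> (x - y) = \<sigma> x - \<sigma> y"
    and hom_mult: "\<sigma> (x * y) = \<sigma> x * \<sigma> y"
    and hom_to_ac: "\<sigma> (to_ac a) = to_ac a"
begin

lemma hom_0 [simp]: "\<sigma> 0 = 0"
  using hom_to_ac[of 0] by simp

lemma hom_1 [simp]: "\<sigma> 1 = 1"
  using hom_to_ac[of 1] by simp

lemma hom_add: "\<sigma> (x + y) = \<sigma> x + \<sigma> y"
  using hom_diff[of x "0 - y"] hom_diff[of 0 y] by simp

lemma hom_eq_0_iff: "\<sigma> x = 0 \<longleftrightarrow> x = 0"
proof
  assume "\<sigma> x = 0"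
  then have "\<sigma> (x * inverse x) = 0" by (simp only: hom_mult) simp
  then show "x = 0" by (cases "x = 0") simp_all
qed simp

lemma inj_hom: "inj \<sigma>"
proof (rule injI)
  fix x y assume "\<sigma> x = \<sigma> y"
  then have "\<sigma> (x - y) = 0" by (simp add: hom_diff)
  then show "x = y" by (simp add: hom_eq_0_iff)
qed

lemma hom_inverse: "\<sigma> (inverse x) = inverse (\<sigma> x)"
proof (cases "x = 0")
  case False
  then have "\<sigma> x * \<sigma> (inverse x) = 1" by (simp flip: hom_mult)
  then show ?thesis by (rule inverse_unique[symmetric])
qed simp

lemma hom_divide: "\<sigma> (x / y) = \<sigma> x / \<sigma> y"
  by (simp add: divide_inverse hom_mult hom_inverse)

lemma hom_eval_ac: "\<sigma> (eval_ac q x) = eval_ac q (\<sigma> x)"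
  by (induction q) (simp_all add: hom_add hom_mult hom_to_ac)

lemma is_root_hom: "is_root q x \<Longrightarrow> is_root q (\<sigma> x)"
  by (simp add: is_root_def flip: hom_eval_ac)

lemma deg_hom: "deg (\<sigma> x) = deg x"
proof -
  obtain p where p: "is_min_poly p x" by (rule is_min_poly_exists)
  then have "monic_irreducible p" "is_root p x"
    by (auto simp only: is_min_poly_iff)
  then have "is_min_poly p (\<sigma> x)"
    unfolding is_min_poly_iff using is_root_hom by blast
  then have "deg (\<sigma> x) = degree p" by (rule deg_eq_degree_min_poly)
  also have "\<dots> = deg x" using deg_eq_degree_min_poly[OF p] ..
  finally show ?thesis .
qed

end

text \<open>
  Partial homomorphisms are represented by their graphs, so that the union of a chain is
  again one.  The domain is a ring that is algebraic over the base field, hence a field, which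
  is what makes nonzero elements have nonzero images.
\<close>

locale partial_hom =
  fixes G :: "('k::field alg_closure \<times> 'k alg_closure) set"
  assumes const: "(to_ac a, to_ac a) \<in> G"
    and diff: "(x, y) \<in> G \<Longrightarrow> (x', y') \<in> G \<Longrightarrow> (x - x', y - y') \<in> G"
    and mult: "(x, y) \<in> G \<Longrightarrow> (x', y') \<in> G \<Longrightarrow> (x * x', y * y') \<in> G"
    and zero: "(0, y) \<in> G \<Longrightarrow> y = 0"
begin

lemma zero_mem: "(0, 0) \<in> G"
  using const[of 0] by simp

lemma one_mem: "(1, 1) \<in> G"
  using const[of 1] by simp

lemma add:
  assumes "(x, y) \<in> G" "(x', y') \<in> G"
  shows "(x + x', y + y') \<in> G"
  using diff[OF assms(1) diff[OF zero_mem assms(2)]] by simp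

lemma sum: "(\<And>i. i \<in> A \<Longrightarrow> (f i, g i) \<in> G) \<Longrightarrow> (sum f A, sum g A) \<in> G"
  by (induction A rule: infinite_finite_induct) (simp_all add: zero_mem add)

lemma unique:
  assumes "(x, y) \<in> G" "(x, y') \<in> G"
  shows "y = y'"
proof -
  have "(0, y - y') \<in> G" using diff[OF assms] by simp
  then have "y - y' = 0" by (rule zero)
  then show ?thesis by simp
qed

lemma eval_ac_mem: "(x, y) \<in> G \<Longrightarrow> (eval_ac q x, eval_ac q y) \<in> G"
  by (induction q) (simp_all add: zero_mem add mult const)

lemma nonzero:
  assumes "(x, y) \<in> G" "x \<noteq> 0"
  shows "y \<noteq> 0"
proof -
  obtain s where "x * eval_ac s x = 1"
    using assms by (elim inverse_eq_eval_ac)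
  then have "(1, y * eval_ac s y) \<in> G"
    using mult[OF assms(1) eval_ac_mem[OF assms(1), of s]] by simp
  then have "y * eval_ac s y = 1"
    using one_mem by (rule unique)
  then show ?thesis by auto
qed

definition image_poly :: "'k alg_closure poly \<Rightarrow> 'k alg_closure poly \<Rightarrow> bool" where
  "image_poly p q \<longleftrightarrow> (\<forall>i. (coeff p i, coeff q i) \<in> G)"

lemma image_poly_diff: "image_poly p q \<Longrightarrow> image_poly p' q' \<Longrightarrow> image_poly (p - p') (q - q')"
  by (auto simp: image_poly_def intro: diff)

lemma image_poly_mult: "image_poly p q \<Longrightarrow> image_poly p' q' \<Longrightarrow> image_poly (p * p') (q * q')"
  by (auto simp: image_poly_def coeff_mult intro!: sum mult)

lemma image_poly_monom: "(a, b) \<in> G \<Longrightarrow> image_poly (monom a n) (monom b n)"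
  by (auto simp: image_poly_def zero_mem)

lemma image_poly_map_poly: "image_poly (map_poly to_ac p) (map_poly to_ac p)"
  by (auto simp: image_poly_def coeff_map_poly const)

lemma image_poly_degree:
  assumes "image_poly p q"
  shows "degree q = degree p"
proof -
  have "coeff q i = 0 \<longleftrightarrow> coeff p i = 0" for i
    using assms zero nonzero by (metis image_poly_def)
  then show ?thesis
    by (simp add: degree_def)
qed

text \<open>
  The hypothesis makes \<open>poly p x \<mapsto> poly q y\<close>, where \<open>q\<close> is the image of \<open>p\<close>, well defined on the
  ring generated by the domain and \<open>x\<close>.
\<close>

lemma adjoin_pair:
  assumes kills: "\<And>p q. image_poly p q \<Longrightarrow> poly p x = 0 \<Longrightarrow> poly q y = 0"
  obtains H where "partial_hom H" "G \<subseteq> H" "(x, y) \<in> H"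
proof -
  define H where "H = {(poly p x, poly q y) | p q. image_poly p q}"
  have mem: "(a, b) \<in> H" if "(a, b) \<in> G" for a b
    unfolding H_def using image_poly_monom[OF that, of 0] by (force simp: poly_monom)
  have "partial_hom H"
  proof
    fix a show "(to_ac a, to_ac a) \<in> H" using mem const .
  next
    fix a b a' b' assume "(a, b) \<in> H" "(a', b') \<in> H"
    then obtain p q p' q' where pq:
      "a = poly p x" "b = poly q y" "image_poly p q" "a' = poly p' x" "b' = poly q' y" "image_poly p' q'"
      unfolding H_def by blast
    have "(poly (p - p') x, poly (q - q') y) \<in> H" "(poly (p * p') x, poly (q * q') y) \<in> H"
      unfolding H_def using pq by (blast intro: image_poly_diff image_poly_mult)+
    then show "(a - a', b - b') \<in> H" "(a * a', b * b') \<in> H"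
      using pq by simp_all
  next
    fix b assume "(0, b) \<in> H"
    then show "b = 0" unfolding H_def using kills by force
  qed
  moreover have "(x, y) \<in> H"
    unfolding H_def using image_poly_monom[OF one_mem, of 1] by (force simp: poly_monom)
  moreover have "G \<subseteq> H" using mem by auto
  ultimately show ?thesis using that by blast
qed

text \<open>
  Let \<open>p\<close> be of least degree among the polynomials over the domain that vanish at \<open>x\<close>, and
  let \<open>y\<close> be a root of its image \<open>q\<close>.  Pseudo-division by \<open>p\<close> shows that every polynomial
  over the domain vanishing at \<open>x\<close> has an image vanishing at \<open>y\<close>.
\<close>

lemma extend_to:
  obtains H y where "partial_hom H" "G \<subseteq> H" "(x, y) \<in> H"
proof -
  let ?P = "\<lambda>p. p \<noteq> 0 \<and> poly p x = 0 \<and> (\<exists>q. image_poly p q)"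
  obtain p0 :: "'k poly" where "p0 \<noteq> 0" "eval_ac p0 x = 0"
    by (rule alg_closure_algebraic)
  then have "?P (map_poly to_ac p0)"
    using image_poly_map_poly by (auto simp: map_poly_eq_0_iff)
  then obtain p where P: "?P p" and min: "\<And>r. ?P r \<Longrightarrow> degree p \<le> degree r"
    using ex_has_least_nat[of ?P _ degree] by blast
  from P obtain q where pq: "image_poly p q" by blast
  have "degree p \<noteq> 0"
  proof
    assume "degree p = 0"
    then obtain c where "p = [:c:]" by (rule degree_eq_zeroE)
    with P show False by auto
  qed
  then have "degree q > 0" using image_poly_degree[OF pq] by simp
  then obtain y where y: "poly q y = 0" using alg_closed_imp_poly_has_root by blast
  define a b where "a = lead_coeff p" and "b = coeff q (degree p)"
  have ab: "(a, b) \<in> G" using pq by (simp add: a_def b_def image_poly_def)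
  moreover have "a \<noteq> 0" using P by (simp add: a_def)
  ultimately have "b \<noteq> 0" by (rule nonzero)
  have "poly s y = 0" if "image_poly r s" "poly r x = 0" for r s
    using that
  proof (induction "degree r" arbitrary: r s rule: less_induct)
    case less
    show ?case
    proof (cases "r = 0")
      case True
      then have "coeff s i = 0" for i
        using less.prems zero by (simp add: image_poly_def)
      then have "s = 0" by (intro poly_eqI) simp
      then show ?thesis by simp
    next
      case False
      then have le: "degree p \<le> degree r" using min less.prems by blast
      define k where "k = degree r - degree p"
      define c where "c = coeff s (degree r)"
      have c: "(lead_coeff r, c) \<in> G" using less.prems by (simp add: c_def image_poly_def)
      define r' where "r' = monom a 0 * r - monom (lead_coeff r) k * p"
      define s' where "s' = monom b 0 * s - monom c k * q"
      have rel: "image_poly r' s'"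
        unfolding r'_def s'_def
        by (intro image_poly_diff image_poly_mult image_poly_monom ab c pq less.prems)
      have "degree r' < degree r"
      proof (rule degree_lessI)
        show "r' \<noteq> 0 \<or> degree r > 0" using le \<open>degree p \<noteq> 0\<close> by simp
        show "\<forall>i\<ge>degree r. coeff r' i = 0"
        proof (intro allI impI)
          fix i assume i: "degree r \<le> i"
          have "coeff (monom (lead_coeff r) k * p) i = lead_coeff r * coeff p (i - k)"
            using i by (simp add: coeff_monom_mult k_def)
          moreover have "i - k = degree p" if "i = degree r" using that le by (simp add: k_def)
          moreover have "i - k > degree p" if "i \<noteq> degree r" using that i le by (simp add: k_def)
          ultimately show "coeff r' i = 0"
            using i by (cases "i = degree r") (auto simp: r'_def a_def coeff_eq_0 monom_0)
        qed
      qed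
      moreover have "poly r' x = 0" using less.prems P by (simp add: r'_def)
      ultimately have "poly s' y = 0" using less.hyps rel by blast
      with y \<open>b \<noteq> 0\<close> show ?thesis by (simp add: s'_def poly_monom)
    qed
  qed
  then obtain H where "partial_hom H" "G \<subseteq> H" "(x, y) \<in> H"
    by (rule adjoin_pair)
  then show ?thesis by (rule that)
qed

end

lemma partial_hom_Union_chain:
  assumes "C \<noteq> {}" and hom: "\<And>G. G \<in> C \<Longrightarrow> partial_hom G"
    and chain: "\<And>G H. G \<in> C \<Longrightarrow> H \<in> C \<Longrightarrow> G \<subseteq> H \<or> H \<subseteq> G"
  shows "partial_hom (\<Union>C)"
proof
  fix a show "(to_ac a, to_ac a) \<in> \<Union>C"
    using \<open>C \<noteq> {}\<close> hom partial_hom.const by blast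
next
  fix x y x' y' assume "(x, y) \<in> \<Union>C" "(x', y') \<in> \<Union>C"
  then obtain G where G: "G \<in> C" "(x, y) \<in> G" "(x', y') \<in> G"
    using chain by blast
  interpret partial_hom G using hom G(1) .
  show "(x - x', y - y') \<in> \<Union>C" "(x * x', y * y') \<in> \<Union>C"
    using G diff mult by blast+
next
  fix y assume "(0, y) \<in> \<Union>C"
  then show "y = 0" using hom partial_hom.zero by blast
qed

text \<open>By Zorn's lemma and the one-step extension, a maximal partial homomorphism is total.\<close>

lemma partial_hom_extends_to_closure_hom:
  assumes "partial_hom G"
  obtains \<sigma> where "closure_hom \<sigma>" "\<And>x y. (x, y) \<in> G \<Longrightarrow> \<sigma> x = y"
proof -
  define A where "A = {H. partial_hom H \<and> G \<subseteq> H}"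
  have "\<exists>M\<in>A. \<forall>H\<in>A. M \<subseteq> H \<longrightarrow> H = M"
  proof (rule subset_Zorn_nonempty)
    show "A \<noteq> {}" using assms by (auto simp: A_def)
    fix C assume C: "C \<noteq> {}" "subset.chain A C"
    then have CA: "C \<subseteq> A" and ch: "\<And>H H'. H \<in> C \<Longrightarrow> H' \<in> C \<Longrightarrow> H \<subseteq> H' \<or> H' \<subseteq> H"
      by (auto simp: subset_chain_def A_def)
    have "partial_hom (\<Union>C)"
      by (rule partial_hom_Union_chain[OF C(1) _ ch]) (use CA in \<open>auto simp: A_def\<close>)
    then show "\<Union>C \<in> A"
      using C(1) CA by (auto simp: A_def)
  qed
  then obtain M where M: "partial_hom M" "G \<subseteq> M" and max: "\<And>H. partial_hom H \<Longrightarrow> M \<subseteq> H \<Longrightarrow> H = M"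
    by (auto simp: A_def)
  interpret partial_hom M by fact
  have total: "\<exists>y. (x, y) \<in> M" for x
    using max by (metis extend_to)
  define \<sigma> where "\<sigma> x = (SOME y. (x, y) \<in> M)" for x
  have mem: "(x, \<sigma> x) \<in> M" for x
    unfolding \<sigma>_def using total by (rule someI_ex)
  have eq: "\<sigma> x = y" if "(x, y) \<in> M" for x y
    using mem that by (rule unique)
  have "closure_hom \<sigma>"
    by unfold_locales (auto intro!: eq diff mult const mem)
  then show ?thesis using that eq M(2) by blast
qed

lemma conjugate_roots:
  fixes p :: "'k::field poly"
  assumes "irreducible p" "is_root p \<alpha>" "is_root p \<beta>"
  obtains \<sigma> where "closure_hom \<sigma>" "\<sigma> \<alpha> = \<beta>"
proof -
  let ?G = "range (\<lambda>a :: 'k. (to_ac a, to_ac a))"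
  interpret partial_hom ?G
    by unfold_locales (auto simp flip: to_ac_diff to_ac_mult)
  have "poly q \<beta> = 0" if rel: "image_poly r q" and r: "poly r \<alpha> = 0" for r q
  proof -
    have c: "coeff q i = coeff r i \<and> to_ac (of_ac (coeff r i)) = coeff r i" for i
    proof -
      have "(coeff r i, coeff q i) \<in> ?G" using rel by (simp add: image_poly_def)
      then show ?thesis by auto
    qed
    define s where "s = map_poly of_ac r"
    have "map_poly to_ac s = r"
      using c by (intro poly_eqI) (simp add: s_def coeff_map_poly)
    moreover have "q = r"
      using c by (intro poly_eqI) simp
    moreover have "p dvd s"
      using assms(1,2) by (rule irreducible_root_dvd) (simp add: is_root_def calculation r)
    then have "is_root s \<beta>"
      using assms(3) by (auto simp: is_root_def elim!: dvdE)
    ultimately show ?thesis by (simp add: is_root_def)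
  qed
  then obtain H where "partial_hom H" and H: "(\<alpha>, \<beta>) \<in> H"
    by (rule adjoin_pair)
  from this(1) obtain \<sigma> where "closure_hom \<sigma>" "\<And>x y. (x, y) \<in> H \<Longrightarrow> \<sigma> x = y"
    using partial_hom_extends_to_closure_hom by blast
  with H that show ?thesis by blast
qed

section \<open>Valuations\<close>

locale valued =
  fixes w :: "'l::field \<Rightarrow> 'g::linordered_ab_group_add extended"
  assumes valuation: "valuation w"
begin

lemma val_neq_Minf: "w x \<noteq> -\<infinity>"
  and val_eq_Pinf_iff: "w x = \<infinity> \<longleftrightarrow> x = 0"
  and val_mult: "w (x * y) = w x + w y"
  and val_add: "min (w x) (w y) \<le> w (x + y)"
  using valuation by (simp_all add: valuation_def)

lemma val_0 [simp]: "w 0 = \<infinity>"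
  by (simp add: val_eq_Pinf_iff)

lemma val_finite:
  assumes "x \<noteq> 0"
  obtains a where "w x = Fin a"
  using assms val_neq_Minf val_eq_Pinf_iff by (cases "w x") blast+

lemma val_1 [simp]: "w 1 = 0"
proof -
  obtain a where a: "w 1 = Fin a" by (rule val_finite[of 1]) simp
  with val_mult[of 1 1] show ?thesis by (simp add: zero_extended_def)
qed

lemma val_uminus [simp]: "w (- x) = w x"
proof -
  obtain a where a: "w (- 1) = Fin a" by (rule val_finite[of "- 1"]) simp
  with val_mult[of "- 1" "- 1"] have "a + a = 0" by (simp add: zero_extended_def)
  then have "a = 0" by simp
  with val_mult[of "- 1" x] a show ?thesis by (simp flip: zero_extended_def)
qed

lemma val_minus_commute: "w (x - y) = w (y - x)"
  using val_uminus[of "x - y"] by simp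

text \<open>The ultrametric inequality; large values of \<open>w (x - y)\<close> mean close points.\<close>

lemma val_triangle: "min (w (x - y)) (w (y - z)) \<le> w (x - z)"
  using val_add[of "x - y" "y - z"] by simp

lemma val_le_iff_divide:
  assumes "x \<noteq> 0"
  shows "w x \<le> w y \<longleftrightarrow> 0 \<le> w (y / x)"
proof (cases "y = 0")
  case False
  obtain a where a: "w x = Fin a" using assms by (rule val_finite)
  obtain b where b: "w (y / x) = Fin b"
    by (rule val_finite[of "y / x"]) (use False assms in simp)
  have "w y = Fin (b + a)" using val_mult[of "y / x" x] assms a b by simp
  then show ?thesis using a b by (simp add: zero_extended_def)
qed simp

lemma valuation_subring_nonneg: "valuation_subring {x. 0 \<le> w x}"
  unfolding valuation_subring_def
proof (intro conjI ballI allI)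
  show "1 \<in> {x. 0 \<le> w x}" by simp
next
  fix x y assume xy: "x \<in> {x. 0 \<le> w x}" "y \<in> {x. 0 \<le> w x}"
  then show "x - y \<in> {x. 0 \<le> w x}" using val_add[of x "- y"] by (auto simp: min_def split: if_splits)
  show "x * y \<in> {x. 0 \<le> w x}" using xy add_mono[of 0 "w x" 0 "w y"] by (simp add: val_mult)
next
  fix x
  show "x \<in> {x. 0 \<le> w x} \<or> inverse x \<in> {x. 0 \<le> w x}"
  proof (cases "x = 0")
    case False
    have "w 1 \<le> w x \<or> w x \<le> w 1" by (rule linear)
    then show ?thesis
      using val_le_iff_divide[of 1 x] val_le_iff_divide[OF False, of 1] by (auto simp: divide_inverse)
  qed simp
qed

end

lemma extends_valuation_nonneg:
  assumes "extends_valuation w v"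
  shows "to_ac -` {x. 0 \<le> w x} = {x. 0 \<le> v x}"
proof -
  obtain j where j: "\<And>a b. j (a + b) = j a + j b" "strict_mono j" "\<And>x. w (to_ac x) = map_extended j (v x)"
    using assms unfolding extends_valuation_def by blast
  have "j 0 = 0" using j(1)[of 0 0] by simp
  then have "0 \<le> j a \<longleftrightarrow> 0 \<le> a" for a
    using strict_mono_less_eq[OF j(2), of 0 a] by simp
  then have "0 \<le> w (to_ac x) \<longleftrightarrow> 0 \<le> v x" for x
    by (cases "v x") (simp_all add: j(3) zero_extended_def)
  then show ?thesis by auto
qed

text \<open>
  The preimage under \<open>\<sigma>\<close> of the valuation ring of \<open>w\<close> is again a valuation ring lying over
  that of \<open>v\<close>, so it is the same ring, and \<open>\<sigma>\<close> is monotone with respect to \<open>w\<close>.  Since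
  \<open>\<sigma>\<close> permutes the finitely many conjugates of \<open>x\<close>, iterating \<open>w x \<le> w (\<sigma> x)\<close> or the
  opposite inequality leads back to \<open>w x\<close>.
\<close>

lemma henselian_val_hom:
  fixes v :: "'k::field \<Rightarrow> 'g::linordered_ab_group_add extended"
    and w :: "'k alg_closure \<Rightarrow> 'h::linordered_ab_group_add extended"
  assumes "henselian v" "valuation w" "extends_valuation w v" "closure_hom \<sigma>"
  shows "w (\<sigma> x) = w x"
proof -
  interpret valued w by unfold_locales fact
  interpret closure_hom \<sigma> by fact
  let ?A = "{x. 0 \<le> w x}"
  have sub: "valuation_subring ?A" by (rule valuation_subring_nonneg)
  have "valuation_subring (\<sigma> -` ?A)"
    using sub by (simp add: valuation_subring_def hom_diff hom_mult hom_inverse)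
  moreover have "to_ac -` (\<sigma> -` ?A) = to_ac -` ?A"
    by (auto simp: hom_to_ac)
  ultimately have preimage: "\<sigma> -` ?A = ?A"
    using assms(1) sub extends_valuation_nonneg[OF assms(3)] unfolding henselian_def by metis
  have nonneg: "0 \<le> w (\<sigma> z) \<longleftrightarrow> 0 \<le> w z" for z
    using preimage by blast
  have mono: "w (\<sigma> a) \<le> w (\<sigma> b)" if "w a \<le> w b" for a b
  proof (cases "a = 0")
    case True
    with that show ?thesis by (simp add: val_eq_Pinf_iff)
  next
    case False
    then show ?thesis
      using that nonneg[of "b / a"] val_le_iff_divide[of a b] val_le_iff_divide[of "\<sigma> a" "\<sigma> b"]
      by (simp add: hom_eq_0_iff hom_divide)
  qed
  obtain p where p: "is_min_poly p x" by (rule is_min_poly_exists)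
  then have "p \<noteq> 0" by (auto simp: is_min_poly_def)
  then have "finite {z. is_root p z}"
    unfolding is_root_def by (intro poly_roots_finite) (simp add: map_poly_eq_0_iff)
  moreover have "is_root p ((\<sigma> ^^ n) x)" for n
    using p by (induction n) (auto simp: is_min_poly_def is_root_hom)
  then have "{y. \<exists>n. y = (\<sigma> ^^ n) x} \<subseteq> {z. is_root p z}" by auto
  ultimately obtain n where n: "n > 0" "(\<sigma> ^^ n) x = x"
    using funpow_inj_finite[OF inj_hom] finite_subset by metis
  show ?thesis
  proof (rule antisym)
    show "w (\<sigma> x) \<le> w x"
    proof (rule ccontr)
      assume "\<not> w (\<sigma> x) \<le> w x"
      then have up: "w x \<le> w (\<sigma> x)" by simp
      have "w ((\<sigma> ^^ i) x) \<le> w ((\<sigma> ^^ Suc i) x)" for i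
        by (induction i) (use up mono in auto)
      then have "w ((\<sigma> ^^ 1) x) \<le> w ((\<sigma> ^^ n) x)"
        by (rule lift_Suc_mono_le) (use n in simp)
      with n \<open>\<not> w (\<sigma> x) \<le> w x\<close> show False by simp
    qed
    show "w x \<le> w (\<sigma> x)"
    proof (rule ccontr)
      assume "\<not> w x \<le> w (\<sigma> x)"
      then have down: "w (\<sigma> x) \<le> w x" by simp
      have "w ((\<sigma> ^^ Suc i) x) \<le> w ((\<sigma> ^^ i) x)" for i
        by (induction i) (use down mono in auto)
      then have "w ((\<sigma> ^^ n) x) \<le> w ((\<sigma> ^^ 1) x)"
        by (rule lift_Suc_antimono_le) (use n in simp)
      with n \<open>\<not> w x \<le> w (\<sigma> x)\<close> show False by simp
    qed
  qed
qed


section \<open>Distinguished pairs and Okutsu sequences\<close>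

context valued
begin

lemma val_diff_eq_of_less:
  assumes "w (x - y) < w (y - z)"
  shows "w (x - z) = w (x - y)"
  using assms val_triangle[of x y z] val_triangle[of x z y] val_minus_commute[of z y]
  by (auto simp: min_def split: if_splits)

end

text \<open>
  The Okutsu sequences measure from \<open>\<theta>\<close>, the distinguished pairs from the neighbour
  \<open>t (Suc i)\<close>.  In either case \<open>w (\<theta> - t i)\<close> increases strictly with \<open>i\<close>, and therefore \<open>\<theta>\<close> and
  \<open>t (Suc i)\<close> see \<open>t i\<close>, and every point that is not closer to \<open>\<theta>\<close> than \<open>t i\<close>, at the same
  distance.  The third condition on a distinguished pair \<open>(t (Suc i), t i)\<close> comes from the
  minimality of the degree \<open>m i\<close> one step earlier; conversely, it yields the strict increase.
\<close>

lemma okutsu_sequences_iff_distinguished_pairs: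
  fixes w :: "'k::field alg_closure \<Rightarrow> 'h::linordered_ab_group_add extended"
  assumes "valuation w" and F: "degree F = deg \<theta>" and t: "t r = \<theta>"
    and m: "\<And>i. i \<le> r \<Longrightarrow> m i = deg (t i)" and mu: "\<And>i. i \<le> r \<Longrightarrow> \<mu> i = w (\<theta> - t i)"
  shows "okutsu_sequences w F \<theta> r m \<mu> \<longleftrightarrow>
    deg (t 0) = 1 \<and> (\<forall>i<r. distinguished_pair w (t (Suc i)) (t i))"
proof
  interpret valued w by unfold_locales fact
  assume ok: "okutsu_sequences w F \<theta> r m \<mu>"
  have m0: "m 0 = 1"
    and less: "\<And>i. i < r \<Longrightarrow> m i < m (Suc i) \<and> \<mu> i < \<mu> (Suc i)"
    and step: "\<And>i. i < r \<Longrightarrow> m (Suc i) = (LEAST d. \<exists>\<eta>. deg \<eta> = d \<and> w (\<theta> - \<eta>) > \<mu> i)"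
    using ok by (auto simp: okutsu_sequences_def)
  have least: "w (\<theta> - \<eta>) \<le> \<mu> i" if "i < r" "deg \<eta> < m (Suc i)" for i \<eta>
    using that not_less_Least[of "deg \<eta>" "\<lambda>d. \<exists>\<eta>. deg \<eta> = d \<and> w (\<theta> - \<eta>) > \<mu> i"]
    by (auto simp: step not_less)
  have "distinguished_pair w (t (Suc i)) (t i)" if i: "i < r" for i
  proof -
    have mu_i: "w (\<theta> - t i) = \<mu> i" "w (\<theta> - t (Suc i)) = \<mu> (Suc i)" and lt: "\<mu> i < \<mu> (Suc i)"
      and m_i: "m i = deg (t i)" "m (Suc i) = deg (t (Suc i))"
      using i mu m less by auto
    have dist: "w (t (Suc i) - \<eta>) = w (\<theta> - \<eta>)" if "w (\<theta> - \<eta>) \<le> \<mu> i" for \<eta>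
      using that lt mu_i val_diff_eq_of_less[of \<eta> \<theta> "t (Suc i)"]
      by (simp add: val_minus_commute[of \<eta>])
    have "w (t (Suc i) - \<beta>) \<le> w (t (Suc i) - t i)" if "deg \<beta> < deg (t (Suc i))" for \<beta>
      using least[of i \<beta>] that i m_i dist mu_i by simp
    moreover have "w (t (Suc i) - \<eta>) < w (t (Suc i) - t i)" if \<eta>: "deg \<eta> < deg (t i)" for \<eta>
    proof (cases i)
      case 0
      with \<eta> m_i m0 deg_pos[of \<eta>] show ?thesis by simp
    next
      case (Suc k)
      then have "w (\<theta> - \<eta>) \<le> \<mu> k" "\<mu> k < \<mu> i" using least[of k \<eta>] less[of k] \<eta> i m_i by auto
      then show ?thesis using dist[of \<eta>] dist[of "t i"] mu_i by auto
    qed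
    ultimately show ?thesis
      using less[OF i] m_i unfolding distinguished_pair_def is_maximum_def by auto
  qed
  then show "deg (t 0) = 1 \<and> (\<forall>i<r. distinguished_pair w (t (Suc i)) (t i))"
    using m0 m by simp
next
  interpret valued w by unfold_locales fact
  assume "deg (t 0) = 1 \<and> (\<forall>i<r. distinguished_pair w (t (Suc i)) (t i))"
  then have t0: "deg (t 0) = 1" and pair: "\<And>i. i < r \<Longrightarrow> distinguished_pair w (t (Suc i)) (t i)"
    by auto
  have deg_less: "deg (t i) < deg (t (Suc i))" if "i < r" for i
    using pair[OF that] by (simp add: distinguished_pair_def)
  have max: "w (t (Suc i) - \<beta>) \<le> w (t (Suc i) - t i)" if "i < r" "deg \<beta> < deg (t (Suc i))" for i \<beta>
    using pair[OF that(1)] that(2) unfolding distinguished_pair_def is_maximum_def by blast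
  have far: "w (t (Suc i) - \<eta>) < w (t (Suc i) - t i)" if "i < r" "deg \<eta> < deg (t i)" for i \<eta>
    using pair[OF that(1)] that(2) unfolding distinguished_pair_def by blast
  \<comment> \<open>If \<open>t i\<close> were as close to \<open>t (Suc i)\<close> as \<open>t (Suc i)\<close> is to \<open>t (Suc (Suc i))\<close>, then it
    would be that close to \<open>t (Suc (Suc i))\<close> as well, although its degree is below that of
    \<open>t (Suc i)\<close>.\<close>
  have incr: "w (t (Suc i) - t i) < w (t (Suc (Suc i)) - t (Suc i))" if "Suc i < r" for i
    using far[of "Suc i" "t i"] deg_less[of i] that
      val_triangle[of "t (Suc (Suc i))" "t (Suc i)" "t i"]
    by (auto simp: min_def not_le split: if_splits)
  have dist: "w (\<theta> - t i) = w (t (Suc i) - t i) \<and> w (\<theta> - t i) < w (\<theta> - t (Suc i))" if "i < r" for i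
    using that
  proof (induction "r - i" arbitrary: i)
    case (Suc d)
    show ?case
    proof (cases "Suc i = r")
      case True
      have "t i \<noteq> \<theta>" using deg_less[OF Suc.prems] True t by auto
      then have "w (\<theta> - t i) \<noteq> \<infinity>" by (simp add: val_eq_Pinf_iff)
      then show ?thesis using True t by (simp add: less_le)
    next
      case False
      with Suc have "Suc i < r" "d = r - Suc i" by auto
      with Suc have IH: "w (\<theta> - t (Suc i)) = w (t (Suc (Suc i)) - t (Suc i))" by blast
      have "w (t i - t (Suc i)) < w (t (Suc i) - \<theta>)"
        using incr[OF \<open>Suc i < r\<close>] IH by (simp add: val_minus_commute[of "t i"] val_minus_commute[of _ \<theta>])
      from val_diff_eq_of_less[OF this] this show ?thesis
        by (simp add: val_minus_commute[of "t i"] val_minus_commute[of _ \<theta>])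
    qed
  qed simp
  have mu_less: "\<mu> i < \<mu> (Suc i)" if "i < r" for i
    using conjunct2[OF dist[OF that]] mu[of i] mu[of "Suc i"] that by simp
  have close: "w (\<theta> - \<eta>) \<le> w (\<theta> - t i)" if "i < r" "deg \<eta> < deg (t (Suc i))" for i \<eta>
    using max[OF that] dist[OF that(1)] val_triangle[of "t (Suc i)" \<theta> \<eta>] val_minus_commute[of \<theta> "t (Suc i)"]
    by (auto simp: min_def split: if_splits)
  have max_i: "is_maximum (\<mu> i) {w (\<theta> - \<eta>) | \<eta>. deg \<eta> = m i}" if "i < r" for i
    unfolding is_maximum_def using close[OF that] deg_less[OF that] that m mu by auto
  have least: "m (Suc i) = (LEAST d. \<exists>\<eta>. deg \<eta> = d \<and> w (\<theta> - \<eta>) > \<mu> i)" if "i < r" for i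
  proof (rule Least_equality[symmetric])
    show "\<exists>\<eta>. deg \<eta> = m (Suc i) \<and> w (\<theta> - \<eta>) > \<mu> i"
      using conjunct2[OF dist[OF that]] that m mu by (intro exI[of _ "t (Suc i)"]) simp
    fix d assume "\<exists>\<eta>. deg \<eta> = d \<and> w (\<theta> - \<eta>) > \<mu> i"
    then show "m (Suc i) \<le> d"
      using close[OF that] that m mu by (force simp: not_less[symmetric])
  qed
  show "okutsu_sequences w F \<theta> r m \<mu>"
    unfolding okutsu_sequences_def
    using t0 t F m mu deg_less mu_less max_i least by simp
qed


section \<open>Chains of polynomials and chains of elements\<close>

text \<open>
  A pair that starts at some root \<open>\<theta>\<close> of \<open>g\<close> is moved to \<open>x\<close> by a homomorphism \<open>\<sigma>\<close>.  To see
  that it is still distinguished, the competitors \<open>\<beta>\<close> of \<open>\<sigma> \<alpha>\<close> are moved back by some \<open>\<tau>\<close> with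
  \<open>\<tau> x = \<theta>\<close>.
\<close>

lemma distinguished_pair_poly_root:
  fixes w :: "'k::field alg_closure \<Rightarrow> 'h::linordered_ab_group_add extended"
  assumes hom: "\<And>\<sigma> x. closure_hom \<sigma> \<Longrightarrow> w (\<sigma> x) = w x"
    and gf: "distinguished_pair_poly w g f" and x: "is_root g x"
  obtains y where "is_root f y" "distinguished_pair w x y"
proof -
  obtain \<theta> \<alpha> where g: "irreducible g" "is_root g \<theta>" and f: "is_root f \<alpha>"
    and pair: "distinguished_pair w \<theta> \<alpha>"
    using gf by (auto simp: distinguished_pair_poly_def monic_irreducible_def)
  obtain \<sigma> where s: "closure_hom \<sigma>" "\<sigma> \<theta> = x" using conjugate_roots[OF g x] .
  obtain \<tau> where t: "closure_hom \<tau>" "\<tau> x = \<theta>" using conjugate_roots[OF g(1) x g(2)] .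
  interpret s: closure_hom \<sigma> by fact
  interpret t: closure_hom \<tau> by fact
  have dist_y: "w (x - \<sigma> \<alpha>) = w (\<theta> - \<alpha>)"
    using hom[OF s(1), of "\<theta> - \<alpha>"] s(2) by (simp add: s.hom_diff)
  have dist: "w (x - \<beta>) = w (\<theta> - \<tau> \<beta>)" for \<beta>
    using hom[OF t(1), of "x - \<beta>"] t(2) by (simp add: t.hom_diff)
  have deg_x: "deg x = deg \<theta>" using t.deg_hom[of x] t(2) by simp
  have "w (x - \<beta>) \<le> w (x - \<sigma> \<alpha>)" if "deg \<beta> < deg x" for \<beta>
  proof -
    have "deg (\<tau> \<beta>) < deg \<theta>" using that deg_x by (simp add: t.deg_hom)
    then show ?thesis
      using pair unfolding dist[of \<beta>] dist_y distinguished_pair_def is_maximum_def by blast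
  qed
  moreover have "w (x - \<eta>) < w (x - \<sigma> \<alpha>)" if "deg \<eta> < deg (\<sigma> \<alpha>)" for \<eta>
  proof -
    have "deg (\<tau> \<eta>) < deg \<alpha>" using that by (simp add: t.deg_hom s.deg_hom)
    then show ?thesis
      using pair unfolding dist[of \<eta>] dist_y distinguished_pair_def by blast
  qed
  moreover have "deg (\<sigma> \<alpha>) < deg x"
    using pair deg_x by (simp add: s.deg_hom distinguished_pair_def)
  ultimately have "distinguished_pair w x (\<sigma> \<alpha>)"
    unfolding distinguished_pair_def is_maximum_def by blast
  with f show ?thesis using that s.is_root_hom by blast
qed

lemma saturated_distinguished_chain_iff:
  fixes w :: "'k::field alg_closure \<Rightarrow> 'h::linordered_ab_group_add extended"
    and Fs :: "'k poly list"
  defines "r \<equiv> length Fs"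
  assumes hom: "\<And>\<sigma> x. closure_hom \<sigma> \<Longrightarrow> w (\<sigma> x) = w x"
    and F: "is_min_poly F \<theta>"
  shows "saturated_distinguished_chain w F (F # rev Fs) \<longleftrightarrow>
    (\<exists>t. t r = \<theta> \<and> deg (t 0) = 1 \<and> (\<forall>i<r. is_min_poly (Fs ! i) (t i)) \<and>
      (\<forall>i<r. distinguished_pair w (t (Suc i)) (t i)))" (is "?L \<longleftrightarrow> ?R")
proof -
  define L where "L = F # rev Fs"
  have len: "length L = Suc r" by (simp add: L_def r_def)
  have L_0: "L ! 0 = F" by (simp add: L_def)
  have L_low: "L ! (r - i) = Fs ! i" if "i < r" for i
    using that by (simp add: L_def r_def rev_nth nth_Cons')
  have last: "last L = L ! r" using len by (metis diff_Suc_1 last_conv_nth length_0_conv nat.distinct(1))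
  show ?thesis
  proof
    assume ?L
    then have irr: "\<And>k. k \<le> r \<Longrightarrow> monic_irreducible (L ! k)"
      and pairs: "\<And>k. k < r \<Longrightarrow> distinguished_pair_poly w (L ! k) (L ! Suc k)"
      and deg_last: "degree (L ! r) = 1"
      using len last unfolding saturated_distinguished_chain_def L_def[symmetric] by simp_all
    \<comment> \<open>The roots are chosen from \<open>\<theta>\<close> downwards, so \<open>s k\<close> is a root of \<open>F\<^sub>r\<^sub>-\<^sub>k\<close>.\<close>
    have "\<exists>s. \<forall>k. ((k = 0 \<longrightarrow> s k = \<theta>) \<and> (k \<le> r \<longrightarrow> is_root (L ! k) (s k))) \<and>
      (k < r \<longrightarrow> distinguished_pair w (s k) (s (Suc k)))"
    proof (rule dependent_nat_choice)
      show "\<exists>x. (0 = 0 \<longrightarrow> x = \<theta>) \<and> (0 \<le> r \<longrightarrow> is_root (L ! 0) x)"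
        using F by (simp add: L_0 is_min_poly_def)
    next
      fix x k assume x: "(k = 0 \<longrightarrow> x = \<theta>) \<and> (k \<le> r \<longrightarrow> is_root (L ! k) x)"
      show "\<exists>y. ((Suc k = 0 \<longrightarrow> y = \<theta>) \<and> (Suc k \<le> r \<longrightarrow> is_root (L ! Suc k) y)) \<and>
        (k < r \<longrightarrow> distinguished_pair w x y)"
      proof (cases "k < r")
        case True
        with x have "is_root (L ! k) x" by simp
        with hom pairs[OF True] obtain y where "is_root (L ! Suc k) y" "distinguished_pair w x y"
          by (rule distinguished_pair_poly_root)
        then show ?thesis by auto
      qed auto
    qed
    then obtain s where s: "s 0 = \<theta>" "\<And>k. k \<le> r \<Longrightarrow> is_root (L ! k) (s k)"
      "\<And>k. k < r \<Longrightarrow> distinguished_pair w (s k) (s (Suc k))"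
      by blast
    have min: "is_min_poly (L ! k) (s k)" if "k \<le> r" for k
      using s(2) irr that by (simp add: is_min_poly_iff)
    define t where "t i = s (r - i)" for i
    have "t r = \<theta>" by (simp add: t_def s)
    moreover have "deg (t 0) = 1"
      using deg_eq_degree_min_poly[OF min[of r]] deg_last by (simp add: t_def)
    moreover have "is_min_poly (Fs ! i) (t i)" if "i < r" for i
      using min[of "r - i"] L_low[OF that] by (simp add: t_def)
    moreover have "distinguished_pair w (t (Suc i)) (t i)" if "i < r" for i
      using s(3)[of "r - Suc i"] that by (simp add: t_def Suc_diff_Suc)
    ultimately show ?R by blast
  next
    assume ?R
    then obtain t where t: "t r = \<theta>" "deg (t 0) = 1" "\<And>i. i < r \<Longrightarrow> is_min_poly (Fs ! i) (t i)"
      and pair: "\<And>i. i < r \<Longrightarrow> distinguished_pair w (t (Suc i)) (t i)"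
      by blast
    have min: "is_min_poly (L ! k) (t (r - k))" if "k \<le> r" for k
      using t(3)[of "r - k"] L_low[of "r - k"] that F t(1) L_0 by (cases "k = 0") simp_all
    have "distinguished_pair_poly w (L ! k) (L ! Suc k)" if "k < r" for k
      using min[of k] min[of "Suc k"] pair[of "r - Suc k"] that
      unfolding distinguished_pair_poly_def is_min_poly_iff by (auto simp: Suc_diff_Suc)
    moreover have "\<forall>G\<in>set L. monic_irreducible G"
      using min len by (auto simp: in_set_conv_nth is_min_poly_iff less_Suc_eq_le)
    moreover have "degree (last L) = 1"
      using deg_eq_degree_min_poly[OF min[of r]] t(2) last by simp
    ultimately show ?L
      using len unfolding saturated_distinguished_chain_def L_def[symmetric] by (auto simp: L_def)
  qed
qed

theorem theorem2p19:
  fixes v :: "'k::field \<Rightarrow> 'g::linordered_ab_group_add extended"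
    and vbar :: "'k alg_closure \<Rightarrow> 'h::linordered_ab_group_add extended"
    and F :: "'k poly" and \<theta> :: "'k alg_closure" and Fs :: "'k poly list"
  assumes "valuation v" and "henselian v"
    and "valuation vbar" and "extends_valuation vbar v"
    and "monic_irreducible F" and "is_root F \<theta>"
  shows "saturated_distinguished_chain vbar F (F # rev Fs) \<longleftrightarrow> okutsu_frame vbar F \<theta> Fs"
proof -
  have F: "is_min_poly F \<theta>" using assms(5,6) by (simp add: is_min_poly_iff)
  have deg_F: "degree F = deg \<theta>" using deg_eq_degree_min_poly[OF F] ..
  define r where "r = length Fs"
  have hom: "vbar (\<sigma> x) = vbar x" if "closure_hom \<sigma>" for \<sigma> x
    using assms(2,3,4) that by (rule henselian_val_hom)
  note sequences = okutsu_sequences_iff_distinguished_pairs[OF assms(3) deg_F]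
  have "okutsu_frame vbar F \<theta> Fs \<longleftrightarrow>
    (\<exists>t. t r = \<theta> \<and> deg (t 0) = 1 \<and> (\<forall>i<r. is_min_poly (Fs ! i) (t i)) \<and>
      (\<forall>i<r. distinguished_pair vbar (t (Suc i)) (t i)))" (is "_ \<longleftrightarrow> ?R")
  proof
    assume "okutsu_frame vbar F \<theta> Fs"
    then obtain m \<mu> u where ok: "okutsu_sequences vbar F \<theta> r m \<mu>"
      and u: "\<And>i. i < r \<Longrightarrow> deg (u i) = m i \<and> vbar (\<theta> - u i) = \<mu> i \<and> is_min_poly (Fs ! i) (u i)"
      unfolding okutsu_frame_def r_def by metis
    define t where "t i = (if i < r then u i else \<theta>)" for i
    have "m r = degree F" "\<mu> r = \<infinity>" using ok by (auto simp: okutsu_sequences_def)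
    moreover have "vbar 0 = \<infinity>" using assms(3) by (simp add: valuation_def)
    ultimately have "m i = deg (t i)" "\<mu> i = vbar (\<theta> - t i)" if "i \<le> r" for i
      using u that deg_F by (auto simp: t_def)
    then have "deg (t 0) = 1 \<and> (\<forall>i<r. distinguished_pair vbar (t (Suc i)) (t i))"
      using ok sequences[of t r m \<mu>] by (simp add: t_def)
    moreover have "t r = \<theta>" "\<And>i. i < r \<Longrightarrow> is_min_poly (Fs ! i) (t i)"
      using u by (simp_all add: t_def)
    ultimately show ?R by blast
  next
    assume ?R
    then obtain t where t: "t r = \<theta>" "\<And>i. i < r \<Longrightarrow> is_min_poly (Fs ! i) (t i)"
      and pairs: "deg (t 0) = 1 \<and> (\<forall>i<r. distinguished_pair vbar (t (Suc i)) (t i))"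
      by blast
    have "okutsu_sequences vbar F \<theta> r (\<lambda>i. deg (t i)) (\<lambda>i. vbar (\<theta> - t i))"
      by (rule sequences[THEN iffD2]) (use t(1) pairs in auto)
    with t assms(5,6) show "okutsu_frame vbar F \<theta> Fs"
      unfolding okutsu_frame_def r_def by blast
  qed
  moreover have "saturated_distinguished_chain vbar F (F # rev Fs) \<longleftrightarrow> ?R"
    unfolding r_def by (rule saturated_distinguished_chain_iff[OF _ F]) (rule hom)
  ultimately show ?thesis by blast
qed

end
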